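(* Let $G$ be an interval colorable graph. Then for every $n\in\mathbb{N}$, $G[K_{2n}]$ is interval colorable, and $$w(G[K_{2n}])\le (2\,w(G)+2)n-1\quad\text{and}\quad W(G[K_{2n}])\ge (2\,W(G)+3)n-2.$$
   Context: All graphs are finite, undirected, without loops or multiple edges. $K_{2n}$ is the complete graph on $2n$ vertices. A proper edge-coloring with consecutive integers $c_1,\ldots,c_t$ is an interval $t$-coloring if all $t$ colors are used and the set of colors on edges incident to each vertex is an interval of integers. A graph is interval colorable if it has an interval $t$-coloring for some positive integer $t$; $w(G)$ and $W(G)$ denote the smallest and largest such $t$. The composition $G[H]$ has vertex set $V(G)\times V(H)$, with $(u_1,v_1)(u_2,v_2)$ an edge iff $u_1u_2\in E(G)$, or $u_1=u_2$ and $v_1v_2\in E(H)$. *)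

theory Defs
  imports Main
begin

record 'a graph =
  verts :: "'a set"
  edges :: "'a set set"

definition simple_graph :: "'a graph \<Rightarrow> bool" where
  "simple_graph G \<longleftrightarrow>
     finite (verts G) \<and> (\<forall>e\<in>edges G. e \<subseteq> verts G \<and> card e = 2)"

definition complete_graph :: "nat \<Rightarrow> nat graph" where
  "complete_graph m =
     \<lparr>verts = {..<m}, edges = {e. e \<subseteq> {..<m} \<and> card e = 2}\<rparr>"

definition composition :: "'a graph \<Rightarrow> 'b graph \<Rightarrow> ('a \<times> 'b) graph" where
  "composition G H =
     \<lparr>verts = verts G \<times> verts H,
      edges = {{(u1, v1), (u2, v2)} | u1 v1 u2 v2.
        (u1, v1) \<in> verts G \<times> verts H \<and> (u2, v2) \<in> verts G \<times> verts H \<and>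
        ({u1, u2} \<in> edges G \<or> u1 = u2 \<and> {v1, v2} \<in> edges H)}\<rparr>"

definition incident_edges :: "'a graph \<Rightarrow> 'a \<Rightarrow> 'a set set" where
  "incident_edges G v = {e \<in> edges G. v \<in> e}"

definition proper_edge_coloring :: "'a graph \<Rightarrow> ('a set \<Rightarrow> int) \<Rightarrow> bool" where
  "proper_edge_coloring G \<alpha> \<longleftrightarrow>
     (\<forall>e\<in>edges G. \<forall>f\<in>edges G. e \<noteq> f \<and> e \<inter> f \<noteq> {} \<longrightarrow> \<alpha> e \<noteq> \<alpha> f)"

(* The colors are any t consecutive integers c, ..., c + t - 1, all of them used.
   The interval {a..b} may be empty, so isolated vertices impose no condition. *)
definition interval_coloring :: "'a graph \<Rightarrow> nat \<Rightarrow> ('a set \<Rightarrow> int) \<Rightarrow> bool" where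
  "interval_coloring G t \<alpha> \<longleftrightarrow>
     proper_edge_coloring G \<alpha> \<and>
     (\<exists>c. \<alpha> ` edges G = {c..<c + int t}) \<and>
     (\<forall>v\<in>verts G. \<exists>a b. \<alpha> ` incident_edges G v = {a..b})"

definition interval_t_colorable :: "'a graph \<Rightarrow> nat \<Rightarrow> bool" where
  "interval_t_colorable G t \<longleftrightarrow> (\<exists>\<alpha>. interval_coloring G t \<alpha>)"

definition interval_colorable :: "'a graph \<Rightarrow> bool" where
  "interval_colorable G \<longleftrightarrow> (\<exists>t>0. interval_t_colorable G t)"

definition min_interval_colors :: "'a graph \<Rightarrow> nat" where
  "min_interval_colors G = (LEAST t. t > 0 \<and> interval_t_colorable G t)"

definition max_interval_colors :: "'a graph \<Rightarrow> nat" where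
  "max_interval_colors G = (GREATEST t. t > 0 \<and> interval_t_colorable G t)"

lemma simple_graph_finite_edges:
  assumes "simple_graph G"
  shows "finite (edges G)"
proof (rule finite_subset)
  show "edges G \<subseteq> Pow (verts G)" using assms by (auto simp: simple_graph_def)
  show "finite (Pow (verts G))" using assms by (simp add: simple_graph_def)
qed

lemma simple_graph_complete_graph: "simple_graph (complete_graph m)"
  by (simp add: simple_graph_def complete_graph_def)

lemma simple_graph_composition:
  assumes "simple_graph G" "simple_graph H"
  shows "simple_graph (composition G H)"
proof -
  have "e \<subseteq> verts (composition G H) \<and> card e = 2"
    if e: "e \<in> edges (composition G H)" for e
  proof -
    obtain u1 v1 u2 v2 where e_eq: "e = {(u1, v1), (u2, v2)}"
      and verts: "(u1, v1) \<in> verts G \<times> verts H" "(u2, v2) \<in> verts G \<times> verts H"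
      and adj: "{u1, u2} \<in> edges G \<or> u1 = u2 \<and> {v1, v2} \<in> edges H"
      using e unfolding composition_def by auto
    have "card {u1, u2} = 2 \<or> card {v1, v2} = 2"
      using adj assms unfolding simple_graph_def by blast
    then have "(u1, v1) \<noteq> (u2, v2)" by auto
    then show ?thesis
      using verts by (simp add: e_eq composition_def)
  qed
  moreover have "finite (verts (composition G H))"
    using assms by (simp add: simple_graph_def composition_def)
  ultimately show ?thesis
    by (simp add: simple_graph_def)
qed

lemma interval_t_colorable_le_card_edges:
  assumes "simple_graph G" "interval_t_colorable G t"
  shows "t \<le> card (edges G)"
proof -
  obtain \<alpha> c where "\<alpha> ` edges G = {c..<c + int t}"
    using assms(2) by (auto simp: interval_t_colorable_def interval_coloring_def)
  then have "card (\<alpha> ` edges G) = t" by simp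
  then show ?thesis
    using card_image_le[OF simple_graph_finite_edges[OF assms(1)], of \<alpha>] by simp
qed

lemma min_interval_colors:
  assumes "interval_colorable G"
  shows "min_interval_colors G > 0" "interval_t_colorable G (min_interval_colors G)"
    and "\<And>t. t > 0 \<Longrightarrow> interval_t_colorable G t \<Longrightarrow> min_interval_colors G \<le> t"
proof -
  obtain t where "t > 0 \<and> interval_t_colorable G t"
    using assms by (auto simp: interval_colorable_def)
  from LeastI[of "\<lambda>t. t > 0 \<and> interval_t_colorable G t", OF this]
  show "min_interval_colors G > 0" "interval_t_colorable G (min_interval_colors G)"
    by (auto simp: min_interval_colors_def)
qed (auto simp: min_interval_colors_def intro: Least_le)

lemma max_interval_colors:
  assumes "simple_graph G" "interval_colorable G"
  shows "max_interval_colors G > 0" "interval_t_colorable G (max_interval_colors G)"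
    and "\<And>t. t > 0 \<Longrightarrow> interval_t_colorable G t \<Longrightarrow> t \<le> max_interval_colors G"
proof -
  let ?P = "\<lambda>t. t > 0 \<and> interval_t_colorable G t"
  have bound: "\<forall>t. ?P t \<longrightarrow> t \<le> card (edges G)"
    using interval_t_colorable_le_card_edges[OF assms(1)] by blast
  obtain t0 where t0: "?P t0"
    using assms(2) by (auto simp: interval_colorable_def)
  have "?P (Greatest ?P)" by (rule GreatestI_nat[where P = ?P, OF t0]) (use bound in blast)
  then show "max_interval_colors G > 0" "interval_t_colorable G (max_interval_colors G)"
    by (auto simp: max_interval_colors_def)
  show "t \<le> max_interval_colors G" if "t > 0" "interval_t_colorable G t" for t
    unfolding max_interval_colors_def
    by (rule Greatest_le_nat[where P = ?P]) (use that bound in blast)+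
qed

end

theory Submission
  imports Defs
begin

text \<open>
  Take an interval coloring \<open>\<beta>\<close> of $K_m$ with colors \<open>0, \<dots>, t' - 1\<close>, where vertex \<open>i\<close> sees
  \<open>s i, \<dots>, s i + m - 2\<close>. The symmetric array \<open>F\<close> with \<open>F i j = \<beta> {i, j}\<close> off the diagonal and
  \<open>F i i = s i + m - 1\<close> colors $K_{m,m}$ so that both copies of \<open>i\<close> see \<open>s i, \<dots>, s i + m - 1\<close>.
  Blow every edge of color \<open>c\<close> of \<open>G\<close> up to this array shifted by \<open>m c\<close>; the copy of $K_m$ over a
  vertex \<open>u\<close> receives \<open>\<beta>\<close> shifted by \<open>m (b + 1)\<close>, where \<open>b\<close> is the largest color at \<open>u\<close>. The shifted
  intervals at \<open>(u, i)\<close> are then consecutive, and \<open>m t + t'\<close> colors are used. For \<open>m = 2 n\<close> one can take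
  \<open>t' = 2 n - 1\<close> (a one-factorization) and \<open>t' = 3 n - 2\<close> (the coloring \<open>spread\<close> below).
\<close>

section \<open>Interval colorings from bijections at the vertices\<close>

text \<open>Two edges sharing a vertex lie in one incidence set, where \<open>\<gamma>\<close> is
  injective, so the bijections give properness and the intervals together; as every edge has an
  endpoint, they also determine the color range. Half-open intervals may be empty, as isolated
  vertices require.\<close>

lemma interval_coloringI:
  assumes G: "simple_graph G"
    and bij: "\<And>v. v \<in> verts G \<Longrightarrow> bij_betw \<gamma> (incident_edges G v) {lo v..<hi v}"
    and cover: "(\<Union>v\<in>verts G. {lo v..<hi v}) = {c..<c + int t}"
  shows "interval_coloring G t \<gamma>"
proof -
  have inc: "\<exists>v\<in>verts G. v \<in> e" if "e \<in> edges G" for e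
    using G that unfolding simple_graph_def by (metis card.empty ex_in_conv subsetD zero_neq_numeral)
  have "edges G = (\<Union>v\<in>verts G. incident_edges G v)"
    using inc by (auto simp: incident_edges_def)
  then have "\<gamma> ` edges G = (\<Union>v\<in>verts G. \<gamma> ` incident_edges G v)"
    by (simp add: image_UN)
  also have "\<dots> = (\<Union>v\<in>verts G. {lo v..<hi v})"
    using bij by (simp add: bij_betw_def)
  finally have range: "\<gamma> ` edges G = {c..<c + int t}"
    using cover by simp
  have "\<gamma> e \<noteq> \<gamma> f" if "e \<in> edges G" "f \<in> edges G" "e \<noteq> f" "e \<inter> f \<noteq> {}" for e f
  proof -
    obtain v where "v \<in> e" "v \<in> f" using \<open>e \<inter> f \<noteq> {}\<close> by blast
    then have "e \<in> incident_edges G v" "f \<in> incident_edges G v" "v \<in> verts G"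
      using that G by (auto simp: incident_edges_def simple_graph_def)
    then show ?thesis
      using bij[of v] \<open>e \<noteq> f\<close> by (auto simp: bij_betw_def dest: inj_onD)
  qed
  moreover have "\<exists>a b. \<gamma> ` incident_edges G v = {a..b}" if "v \<in> verts G" for v
  proof -
    have "{lo v..<hi v} = {lo v..hi v - 1}" by auto
    then show ?thesis using bij[OF that] by (metis bij_betw_imp_surj_on)
  qed
  ultimately show ?thesis
    using range by (auto simp: interval_coloring_def proper_edge_coloring_def)
qed

lemma int_div_bounds:
  fixes a b m x :: int
  assumes "m > 0" "m * a \<le> x" "x < m * (b + 1)"
  shows "a \<le> x div m" "x div m \<le> b"
proof -
  show "a \<le> x div m" using zdiv_mono1[OF assms(2,1)] assms(1) by simp
  have "m * (x div m) \<le> x"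
    using pos_mod_sign[OF assms(1), of x] mult_div_mod_eq[of m x] by linarith
  then have "m * (x div m) < m * (b + 1)" using assms(3) by linarith
  then show "x div m \<le> b" using assms(1) by simp
qed

text \<open>Division with remainder by \<open>m\<close>: \<open>f x\<close> is the leading digit and
  \<open>g y - s\<close> the last one. This merges an interval of colors at \<open>u\<close> and a
  row of the array into one interval.\<close>

lemma bij_betw_pair_digits:
  fixes f :: "'b \<Rightarrow> int" and g :: "'c \<Rightarrow> int"
  assumes f: "bij_betw f X {a..b}" and g: "bij_betw g Y {s..<s + m}" and m: "m > 0"
  shows "bij_betw (\<lambda>(x, y). m * f x + g y) (X \<times> Y) {m * a + s..<m * (b + 1) + s}"
proof -
  have "bij_betw (\<lambda>(p, q). m * p + q) ({a..b} \<times> {s..<s + m}) {m * a + s..<m * (b + 1) + s}"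
  proof (rule bij_betw_byWitness[where f' = "\<lambda>z. ((z - s) div m, s + (z - s) mod m)"])
    have "(m * p + q - s) div m = p \<and> s + (m * p + q - s) mod m = q" if "s \<le> q" "q < s + m" for p q
    proof -
      have "m * p + q - s = (q - s) + m * p" by simp
      moreover have "(q - s) div m = 0" "(q - s) mod m = q - s" using that by auto
      ultimately show ?thesis using m by (simp only: div_mult_self2 mod_mult_self2) simp
    qed
    then show "\<forall>x\<in>{a..b} \<times> {s..<s + m}.
        (\<lambda>z. ((z - s) div m, s + (z - s) mod m)) (case x of (p, q) \<Rightarrow> m * p + q) = x"
      by auto
    show "\<forall>z\<in>{m * a + s..<m * (b + 1) + s}.
        (case ((z - s) div m, s + (z - s) mod m) of (p, q) \<Rightarrow> m * p + q) = z"
      by simp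
    show "(\<lambda>(p, q). m * p + q) ` ({a..b} \<times> {s..<s + m}) \<subseteq> {m * a + s..<m * (b + 1) + s}"
    proof -
      have "m * a + s \<le> m * p + q \<and> m * p + q < m * (b + 1) + s"
        if "a \<le> p" "p \<le> b" "s \<le> q" "q < s + m" for p q
      proof -
        have "m * a \<le> m * p" "m * p \<le> m * b" using that m by (auto intro: mult_left_mono)
        then show ?thesis using that unfolding distrib_left by linarith
      qed
      then show ?thesis by auto
    qed
    show "(\<lambda>z. ((z - s) div m, s + (z - s) mod m)) ` {m * a + s..<m * (b + 1) + s}
        \<subseteq> {a..b} \<times> {s..<s + m}"
    proof -
      have "a \<le> (z - s) div m \<and> (z - s) div m \<le> b"
        if "m * a + s \<le> z" "z < m * (b + 1) + s" for z
      proof -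
        have "m * a \<le> z - s" "z - s < m * (b + 1)" using that by auto
        then show ?thesis using int_div_bounds[OF m] by blast
      qed
      then show ?thesis using m by auto
    qed
  qed
  moreover have "bij_betw (map_prod f g) (X \<times> Y) ({a..b} \<times> {s..<s + m})"
    using f g by (rule bij_betw_map_prod)
  ultimately have "bij_betw ((\<lambda>(p, q). m * p + q) \<circ> map_prod f g) (X \<times> Y) {m * a + s..<m * (b + 1) + s}"
    by (rule bij_betw_trans[rotated])
  moreover have "(\<lambda>(p, q). m * p + q) \<circ> map_prod f g = (\<lambda>(x, y). m * f x + g y)"
    by auto
  ultimately show ?thesis by simp
qed

section \<open>Interval colorings of a composition with a complete graph\<close>

text \<open>A singleton \<open>{u}\<close> stands for the copy of $K_m$ over \<open>u\<close> and gets the color following those at \<open>u\<close>.\<close>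

lemma interval_coloring_extend_singletons:
  assumes G: "simple_graph G" and \<alpha>: "interval_coloring G t \<alpha>"
  obtains A a c where
    "\<And>u. u \<in> verts G \<Longrightarrow> bij_betw (\<lambda>w. A {u, w}) (insert u {w. {u, w} \<in> edges G}) {a u..A {u}}"
    "A ` edges G = {c..<c + int t}"
    "\<And>u. u \<in> verts G \<Longrightarrow> c \<le> a u \<and> A {u} \<le> c + int t"
proof -
  obtain c where c: "\<alpha> ` edges G = {c..<c + int t}"
    using \<alpha> by (auto simp: interval_coloring_def)
  \<comment> \<open>In half-open form the upper end \<open>y\<close> is the color following those at
    \<open>u\<close>, and it also exists for an isolated vertex.\<close>
  have "\<exists>x y. bij_betw \<alpha> (incident_edges G u) {x..<y} \<and> c \<le> x \<and> x \<le> y \<and> y \<le> c + int t"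
    if u: "u \<in> verts G" for u
  proof (cases "incident_edges G u = {}")
    case True
    then show ?thesis by (intro exI[of _ c]) (simp add: bij_betw_def)
  next
    case False
    obtain x y where xy: "\<alpha> ` incident_edges G u = {x..y}"
      using \<alpha> u unfolding interval_coloring_def by blast
    have "inj_on \<alpha> (incident_edges G u)"
      using \<alpha> unfolding interval_coloring_def proper_edge_coloring_def incident_edges_def inj_on_def
      by blast
    moreover have "{x..y} = {x..<y + 1}" by auto
    ultimately have "bij_betw \<alpha> (incident_edges G u) {x..<y + 1}"
      using xy by (simp add: bij_betw_def)
    moreover have "x \<le> y" using xy False by force
    moreover have "{x..y} \<subseteq> {c..<c + int t}"
      using xy c by (auto simp: incident_edges_def)
    then have "c \<le> x" "y + 1 \<le> c + int t" using \<open>x \<le> y\<close> by auto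
    ultimately show ?thesis by (intro exI[of _ x] exI[of _ "y + 1"]) simp
  qed
  then obtain a b where ab: "\<And>u. u \<in> verts G \<Longrightarrow> bij_betw \<alpha> (incident_edges G u) {a u..<b u}"
      "\<And>u. u \<in> verts G \<Longrightarrow> c \<le> a u \<and> a u \<le> b u \<and> b u \<le> c + int t"
    by metis
  define A where "A e = (if e \<in> edges G then \<alpha> e else b (the_elem e))" for e
  have nsing: "{u} \<notin> edges G" for u using G by (auto simp: simple_graph_def)
  have A1: "A {u} = b u" for u using nsing by (simp add: A_def)
  show thesis
  proof (rule that[of A a c])
    fix u assume u: "u \<in> verts G"
    let ?N = "{w. {u, w} \<in> edges G}"
    have "bij_betw (\<lambda>w. {u, w}) ?N (incident_edges G u)"
      unfolding bij_betw_def
    proof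
      show "inj_on (\<lambda>w. {u, w}) ?N" by (auto simp: inj_on_def doubleton_eq_iff)
      have "\<exists>w. e = {u, w}" if "e \<in> edges G" "u \<in> e" for e
        using G that unfolding simple_graph_def by (metis card_2_iff empty_iff insert_commute insert_iff)
      then show "(\<lambda>w. {u, w}) ` ?N = incident_edges G u"
        by (auto simp: incident_edges_def image_iff)
    qed
    then have "bij_betw (\<alpha> \<circ> (\<lambda>w. {u, w})) ?N {a u..<b u}"
      using ab(1)[OF u] by (rule bij_betw_trans)
    then have "bij_betw (\<lambda>w. A {u, w}) ?N {a u..<b u}"
      by (rule bij_betw_cong[THEN iffD1, rotated]) (simp add: A_def)
    then have "bij_betw (\<lambda>w. A {u, w}) (?N \<union> {u}) ({a u..<b u} \<union> {A {u, u}})"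
      using nsing by (intro notIn_Un_bij_betw) (auto simp: A1)
    moreover have "{a u..<b u} \<union> {A {u, u}} = {a u..A {u}}"
      using ab(2)[OF u] by (auto simp: A1)
    ultimately show "bij_betw (\<lambda>w. A {u, w}) (insert u ?N) {a u..A {u}}"
      by simp
  next
    show "A ` edges G = {c..<c + int t}" using c by (simp add: A_def)
  next
    fix u assume "u \<in> verts G"
    then show "c \<le> a u \<and> A {u} \<le> c + int t" using ab(2)[of u] by (simp add: A1)
  qed
qed

text \<open>Row \<open>i\<close> of \<open>F\<close> without its largest value \<open>F i i\<close>
  is \<open>{s i..<s i + int m - 1}\<close>, so \<open>F\<close> off the diagonal plays the role of
  the coloring of $K_m$. With the extended coloring \<open>A\<close> as leading digit, edges between
  copies and inside a copy are treated alike.\<close>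

lemma interval_t_colorable_composition:
  fixes F :: "nat \<Rightarrow> nat \<Rightarrow> int" and s :: "nat \<Rightarrow> int"
  assumes G: "simple_graph G" and \<alpha>: "interval_t_colorable G t" and t: "t > 0" and m: "m > 0"
    and sym: "\<And>i j. F i j = F j i"
    and bijF: "\<And>i. i < m \<Longrightarrow> bij_betw (F i) {..<m} {s i..<s i + int m}"
    and diag: "\<And>i. i < m \<Longrightarrow> F i i = s i + int m - 1"
    and coverF: "(\<Union>i<m. {s i..<s i + int m - 1}) = {0..<int t'}"
    and s: "\<And>i. i < m \<Longrightarrow> 0 \<le> s i" "\<exists>i<m. s i = 0"
    and le: "\<And>i. i < m \<Longrightarrow> s i + int m - 1 \<le> int t'"
  shows "interval_t_colorable (composition G (complete_graph m)) (m * t + t')"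
proof -
  let ?C = "composition G (complete_graph m)" and ?m = "int m"
  obtain \<beta> where \<beta>: "interval_coloring G t \<beta>"
    using \<alpha> by (auto simp: interval_t_colorable_def)
  obtain A a c where
    A: "\<And>u. u \<in> verts G \<Longrightarrow> bij_betw (\<lambda>w. A {u, w}) (insert u {w. {u, w} \<in> edges G}) {a u..A {u}}"
    and Ac: "A ` edges G = {c..<c + int t}"
    and ac: "\<And>u. u \<in> verts G \<Longrightarrow> c \<le> a u \<and> A {u} \<le> c + int t"
    by (rule interval_coloring_extend_singletons[OF G \<beta>]) (rule that)
  \<comment> \<open>The first coordinates of \<open>e\<close> form an edge of \<open>G\<close>, or a
    singleton if \<open>e\<close> lies inside a copy. \<open>Min\<close> and \<open>Max\<close>
    recover both indices of an unordered edge, even when they coincide.\<close>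
  define \<gamma> where "\<gamma> e = ?m * A (fst ` e) + F (Min (snd ` e)) (Max (snd ` e))" for e :: "('a \<times> nat) set"
  have \<gamma>: "\<gamma> {(u, i), (w, j)} = ?m * A {u, w} + F i j" for u w i j
    using sym[of i j] by (auto simp: \<gamma>_def min_def max_def)
  have Cv: "verts ?C = verts G \<times> {..<m}"
    by (simp add: composition_def complete_graph_def)
  define lo where "lo = (\<lambda>(u, i). ?m * a u + s i)"
  \<comment> \<open>This is \<open>?m * A {u} + F i i\<close>, the value that \<open>(u, i)\<close>
    would contribute to its own row. It is the largest there, so leaving it out still gives an
    interval.\<close>
  define hi where "hi = (\<lambda>(u, i). ?m * (A {u} + 1) + s i - 1)"
  have "interval_coloring ?C (m * t + t') \<gamma>"
  proof (rule interval_coloringI)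
    show "simple_graph ?C"
      using G simple_graph_complete_graph by (rule simple_graph_composition)
  next
    fix v assume "v \<in> verts ?C"
    then obtain u i where v: "v = (u, i)" and u: "u \<in> verts G" and i: "i < m"
      by (auto simp: Cv)
    let ?N = "insert u {w. {u, w} \<in> edges G}"
    let ?D = "?N \<times> {..<m} - {(u, i)}"
    have "bij_betw (\<lambda>(w, j). ?m * A {u, w} + F i j) (?N \<times> {..<m}) {?m * a u + s i..<?m * (A {u} + 1) + s i}"
      using bij_betw_pair_digits[OF A[OF u] bijF[OF i]] m by simp
    moreover have "bij_betw (\<lambda>(w, j). ?m * A {u, w} + F i j) {(u, i)} {hi v}"
      using diag[OF i] by (simp add: bij_betw_def hi_def v algebra_simps)
    moreover have "hi v \<in> {?m * a u + s i..<?m * (A {u} + 1) + s i}"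
    proof -
      have "a u \<le> A {u}"
        using bij_betw_apply[OF A[OF u], of u] by simp
      then have "?m * a u \<le> ?m * A {u}" by (rule mult_left_mono) simp
      moreover have "hi v = ?m * A {u} + ?m + s i - 1" by (simp add: hi_def v distrib_left)
      ultimately have "?m * a u + s i \<le> hi v" "hi v < ?m * A {u} + ?m + s i" using m by linarith+
      then show ?thesis by (simp add: distrib_left)
    qed
    ultimately have "bij_betw (\<lambda>(w, j). ?m * A {u, w} + F i j) ?D
        ({?m * a u + s i..<?m * (A {u} + 1) + s i} - {hi v})"
      using i by (intro bij_betw_DiffI) auto
    moreover have "{?m * a u + s i..<?m * (A {u} + 1) + s i} - {hi v} = {lo v..<hi v}"
      by (auto simp: lo_def hi_def v)
    moreover have "(\<lambda>(w, j). ?m * A {u, w} + F i j) = \<gamma> \<circ> (\<lambda>x. {(u, i), x})"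
      by (rule ext) (simp add: \<gamma> split: prod.split)
    ultimately have D: "bij_betw (\<gamma> \<circ> (\<lambda>x. {(u, i), x})) ?D {lo v..<hi v}"
      by simp
    have "bij_betw (\<lambda>x. {(u, i), x}) ?D (incident_edges ?C v)"
      unfolding bij_betw_def
    proof
      show "inj_on (\<lambda>x. {(u, i), x}) ?D" by (auto simp: inj_on_def doubleton_eq_iff)
      have GV: "w \<in> verts G" if "{u, w} \<in> edges G" for w
        using G that by (auto simp: simple_graph_def)
      show "(\<lambda>x. {(u, i), x}) ` ?D = incident_edges ?C v" (is "?L = ?R")
      proof
        have "{(u, i), (w, j)} \<in> edges ?C" if "(w, j) \<in> ?D" for w j
        proof -
          have "{u, w} \<in> edges G \<or> u = w \<and> {i, j} \<in> edges (complete_graph m)"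
            using that i by (auto simp: complete_graph_def)
          moreover have "w \<in> verts G" using that GV u by auto
          ultimately show ?thesis
            using that u i unfolding composition_def complete_graph_def by auto
        qed
        then show "?L \<subseteq> ?R" by (auto simp: incident_edges_def v)
      next
        show "?R \<subseteq> ?L"
        proof
          fix e assume "e \<in> ?R"
          then obtain u1 v1 u2 v2 where e: "e = {(u1, v1), (u2, v2)}" "v1 < m" "v2 < m"
              "{u1, u2} \<in> edges G \<or> u1 = u2 \<and> {v1, v2} \<in> edges (complete_graph m)" "(u, i) \<in> e"
            unfolding incident_edges_def composition_def complete_graph_def v by auto
          have "u1 \<noteq> u2 \<or> v1 \<noteq> v2"
            using e(4) G by (auto simp: complete_graph_def simple_graph_def)
          then have ne: "(u1, v1) \<noteq> (u2, v2)" by simp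
          have adj: "u2 \<in> insert u1 {w. {u1, w} \<in> edges G}" "u1 \<in> insert u2 {w. {u2, w} \<in> edges G}"
            using e(4) by (auto simp: insert_commute)
          from e(1,5) consider "(u, i) = (u1, v1)" | "(u, i) = (u2, v2)" by blast
          then have "\<exists>x\<in>?D. e = {(u, i), x}"
          proof cases
            case 1
            then show ?thesis using e(1,3) adj ne by (intro bexI[of _ "(u2, v2)"]) auto
          next
            case 2
            then show ?thesis using e(1,2) adj ne by (intro bexI[of _ "(u1, v1)"]) auto
          qed
          then show "e \<in> ?L" by blast
        qed
      qed
    qed
    then show "bij_betw \<gamma> (incident_edges ?C v) {lo v..<hi v}"
      using bij_betw_comp_iff D by blast
  next
    let ?c = "?m * c"
    show "(\<Union>v\<in>verts ?C. {lo v..<hi v}) = {?c..<?c + int (m * t + t')}" (is "?L = ?R")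
    proof
      have "?c \<le> lo (u, i) \<and> hi (u, i) \<le> ?c + int (m * t + t')" if "u \<in> verts G" "i < m" for u i
      proof -
        have "?m * c \<le> ?m * a u" "?m * A {u} \<le> ?m * (c + int t)"
          using ac[OF that(1)] by (auto intro: mult_left_mono)
        then show ?thesis
          using s(1)[OF that(2)] le[OF that(2)] by (simp add: lo_def hi_def algebra_simps)
      qed
      then show "?L \<subseteq> ?R" by (force simp: Cv)
    next
      \<comment> \<open>The color \<open>A {u}\<close> of the singleton exceeds the colors of all
        edges at \<open>u\<close>, so an end of an edge of color \<open>p\<close> serves.\<close>
      have end_vertex: "\<exists>u\<in>verts G. a u \<le> p \<and> p < A {u}" if "p \<in> {c..<c + int t}" for p
      proof -
        have "p \<in> A ` edges G" using that unfolding Ac .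
        then obtain e where e: "e \<in> edges G" "A e = p" by blast
        then obtain u w where uw: "e = {u, w}" "u \<noteq> w"
          using G unfolding simple_graph_def by (metis card_2_iff)
        then have u: "u \<in> verts G" using e G by (auto simp: simple_graph_def)
        have "A {u, w} \<in> {a u..A {u}}"
          using bij_betw_apply[OF A[OF u], of w] e uw by simp
        moreover have "A {u, w} \<noteq> A {u, u}"
          using inj_onD[OF bij_betw_imp_inj_on[OF A[OF u]], of w u] e uw by auto
        ultimately show ?thesis using u e uw by force
      qed
      show "?R \<subseteq> ?L"
      proof
        fix x assume x: "x \<in> ?R"
        \<comment> \<open>Blocks of edge colors are covered at an end \<open>u\<close> of an edge of
          that color, with \<open>s i = 0\<close>. The values beyond them come from the copy over an
          end of an edge of the top color \<open>c + int t - 1\<close>, where \<open>A {u}\<close>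
          reaches \<open>c + int t\<close>.\<close>
        show "x \<in> ?L"
        proof (cases "x < ?m * (c + int t)")
          case True
          define p where "p = x div ?m"
          have m0: "?m > 0" using m by simp
          have "?m * p + x mod ?m = x" by (simp add: p_def)
          then have p: "?m * p \<le> x" "x < ?m * p + ?m"
            using pos_mod_sign[OF m0, of x] pos_mod_bound[OF m0, of x] by linarith+
          have "?m * c \<le> x" using x by simp
          moreover have "x < ?m * (c + int t - 1 + 1)" using True by simp
          ultimately have "c \<le> p" "p \<le> c + int t - 1"
            using int_div_bounds[OF m0] unfolding p_def by blast+
          then have "p \<in> {c..<c + int t}" by simp
          then obtain u where u: "u \<in> verts G" "a u \<le> p" "p + 1 \<le> A {u}"
            using end_vertex by fastforce
          obtain i where i: "i < m" "s i = 0" using s(2) by blast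
          have "?m * a u \<le> ?m * p" "?m * (p + 1) \<le> ?m * A {u}"
            using u by (auto intro: mult_left_mono)
          then have "lo (u, i) \<le> x" "x < hi (u, i)"
            using p i m unfolding lo_def hi_def distrib_left prod.case by linarith+
          then show ?thesis using u i by (force simp: Cv)
        next
          case False
          let ?r = "x - ?m * (c + int t)"
          have "?r \<in> {0..<int t'}" using x False by (simp add: algebra_simps)
          then obtain i where i: "i < m" "s i \<le> ?r" "?r < s i + ?m - 1"
            unfolding coverF[symmetric] by auto
          obtain u where u: "u \<in> verts G" "a u \<le> c + int t" "c + int t \<le> A {u}"
            using end_vertex[of "c + int t - 1"] t by fastforce
          have "?m * a u \<le> ?m * (c + int t)" "?m * (c + int t) \<le> ?m * A {u}"
            using u by (auto intro: mult_left_mono)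
          then have "lo (u, i) \<le> x" "x < hi (u, i)"
            using i unfolding lo_def hi_def distrib_left prod.case by linarith+
          then show ?thesis using u i by (force simp: Cv)
        qed
      qed
    qed
  qed
  then show ?thesis unfolding interval_t_colorable_def by blast
qed

text \<open>By counting, a map on \<open>m\<close> elements that reaches \<open>m\<close> values is
  injective, so it suffices to find a partner for each color.\<close>

lemma bij_betw_nat_int_interval:
  fixes f :: "nat \<Rightarrow> int"
  assumes "\<And>c. s \<le> c \<Longrightarrow> c < s + int m \<Longrightarrow> \<exists>j<m. f j = c"
  shows "bij_betw f {..<m} {s..<s + int m}"
proof -
  have sub: "{s..<s + int m} \<subseteq> f ` {..<m}" using assms by force
  have "card (f ` {..<m}) \<le> m" using card_image_le[of "{..<m}" f] by simp
  then have eq: "f ` {..<m} = {s..<s + int m}"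
    using sub by (intro card_subset_eq[symmetric] card_seteq[symmetric]) auto
  then have "inj_on f {..<m}" by (intro eq_card_imp_inj_on) auto
  with eq show ?thesis by (simp add: bij_betw_def)
qed

section \<open>Interval colorings of the complete graph\<close>

text \<open>The circle method for a one-factorization of $K_{2n}$, with
  \<open>M = 2 * n - 1\<close>: the edge from \<open>i\<close> to the extra vertex \<open>M\<close>
  takes the color that a loop at \<open>i\<close> would have. The diagonal value \<open>M\<close>
  follows all edge colors.\<close>

definition round_robin :: "nat \<Rightarrow> nat \<Rightarrow> nat \<Rightarrow> nat" where
  "round_robin M i j =
     (if i = j then M
      else if i = M then 2 * j mod M
      else if j = M then 2 * i mod M
      else (i + j) mod M)"

lemma bij_betw_round_robin:
  assumes M: "M = 2 * n - 1" and n: "n \<ge> 1" and i: "i < 2 * n"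
  shows "bij_betw (\<lambda>j. int (round_robin M i j)) {..<2 * n} {0..<0 + int (2 * n)}"
proof (rule bij_betw_nat_int_interval)
  fix c' :: int assume c': "0 \<le> c'" "c' < 0 + int (2 * n)"
  then obtain c where c: "c' = int c" "c < 2 * n" by (metis add_0 nonneg_int_cases of_nat_less_iff)
  have "\<exists>j<2 * n. round_robin M i j = c"
  proof (cases "c = M")
    case True
    then show ?thesis using i by (intro exI[of _ i]) (simp add: round_robin_def)
  next
    case False
    then have cM: "c < M" using c M by linarith
    show ?thesis
    proof (cases "i = M")
      case True
      show ?thesis
      proof (cases "even c")
        case True
        then show ?thesis using \<open>i = M\<close> cM M
          by (intro exI[of _ "c div 2"]) (auto simp: round_robin_def)
      next
        case False
        \<comment> \<open>Since \<open>M\<close> is odd, an odd \<open>c\<close> is halved modulo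
          \<open>M\<close> by adding \<open>M\<close> first.\<close>
        then have "even (c + M)" using M n by auto
        then have "2 * ((c + M) div 2) = c + M" by simp
        moreover from this have "(c + M) div 2 < M" using cM by linarith
        moreover have "(c + M) mod M = c" using cM by simp
        moreover have "M < 2 * n" using M n by simp
        ultimately show ?thesis using \<open>i = M\<close>
          by (intro exI[of _ "(c + M) div 2"]) (simp add: round_robin_def)
      qed
    next
      case False
      then have iM: "i < M" using i M by linarith
      \<comment> \<open>The residue solving \<open>i + j = c\<close> modulo \<open>M\<close>; if it
        is \<open>i\<close> itself, the partner is \<open>M\<close>.\<close>
      define j where "j = (c + M - i) mod M"
      have jM: "j < M" using cM by (simp add: j_def)
      have "(i + j) mod M = (i + (c + M - i)) mod M" unfolding j_def by (simp add: mod_add_right_eq)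
      also have "\<dots> = c" using iM cM by simp
      finally have ij: "(i + j) mod M = c" .
      show ?thesis
      proof (cases "j = i")
        case True
        then show ?thesis using ij iM M
          by (intro exI[of _ M]) (auto simp: round_robin_def mult_2)
      next
        case False
        then show ?thesis using ij iM jM M
          by (intro exI[of _ j]) (auto simp: round_robin_def)
      qed
    qed
  qed
  then show "\<exists>j<2 * n. int (round_robin M i j) = c'" using c by auto
qed

lemma interval_t_colorable_composition_few:
  assumes "simple_graph G" "interval_t_colorable G t" "t > 0" "n \<ge> 1"
  shows "interval_t_colorable (composition G (complete_graph (2 * n))) (2 * n * t + (2 * n - 1))"
proof (rule interval_t_colorable_composition[OF assms(1-3),
      where F = "\<lambda>i j. int (round_robin (2 * n - 1) i j)" and s = "\<lambda>_. 0"])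
  show "int (round_robin (2 * n - 1) i j) = int (round_robin (2 * n - 1) j i)" for i j
    by (simp add: round_robin_def add.commute)
  show "bij_betw (\<lambda>j. int (round_robin (2 * n - 1) i j)) {..<2 * n} {0..<0 + int (2 * n)}"
    if "i < 2 * n" for i
    using assms that by (intro bij_betw_round_robin) auto
  show "(\<Union>i<2 * n. {0..<0 + int (2 * n) - 1}) = {0..<int (2 * n - 1)}"
    using assms(4) by (auto simp: of_nat_diff lessThan_empty_iff)
  show "\<exists>i<2 * n. (0::int) = 0" using assms(4) by (intro exI[of _ 0]) simp
qed (use assms in \<open>auto simp: round_robin_def\<close>)

section \<open>A coloring of the complete graph on 2n vertices with 3n - 2 colors\<close>

text \<open>
  The vertices are \<open>i\<close> for \<open>i < n\<close> and \<open>k + n - 1\<close> for \<open>1 \<le> k \<le> n\<close>. Counting colors from 1, two vertices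
  of the same kind get \<open>i + j\<close>, increased by \<open>n - 1\<close> once it reaches \<open>n\<close>. Vertex \<open>i\<close> then misses only the
  would-be color of the loop at \<open>i\<close> in these two ranges, and so does \<open>k + n - 1\<close> for \<open>k = i\<close>; the edge
  between them takes that color, and the remaining mixed edges fill the gap between the ranges.
  The diagonal holds the entry \<open>F i i\<close> of the array above.
\<close>

definition spread_start :: "nat \<Rightarrow> nat \<Rightarrow> nat" where
  "spread_start n v = (if v < n then v - 1 else min (v + 1 - n) (n - 1))"

text \<open>The argument is an index sum, counting colors from 1, and the value counts from 0. The
  colors jumped over are \<open>n - 1\<close> to \<open>2 * n - 3\<close>.\<close>

definition spread_skip :: "nat \<Rightarrow> nat \<Rightarrow> int" where
  "spread_skip n k = (if k < n then int k - 1 else int k + int n - 2)"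

text \<open>For a mixed pair put \<open>k = b + 1 - n\<close>. If \<open>k \<noteq> a\<close>, the
  last two branches are the two cases of \<open>n - 1 + (k - a - 1) mod n\<close>; the branch before
  them replaces this value by the loop color when \<open>k = a\<close>.\<close>

definition spread :: "nat \<Rightarrow> nat \<Rightarrow> nat \<Rightarrow> int" where
  "spread n i j =
     (let a = min i j; b = max i j in
      if a = b then int (spread_start n a) + 2 * int n - 1
      else if b < n then spread_skip n (a + b)
      else if n \<le> a then spread_skip n (a + b + 2 - 2 * n)
      else if b + 1 = a + n then spread_skip n (2 * a)
      else if a + n \<le> b then int b - int a - 1
      else int b - int a + int n - 1)"

lemma spread_low_low:
  assumes "i < n" "j < n" "i \<noteq> j"
  shows "spread n i j = spread_skip n (i + j)"
  using assms by (auto simp: spread_def Let_def min_def max_def add.commute)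

lemma spread_low_high:
  assumes "i < n" "1 \<le> k"
  shows "spread n i (k + n - 1) =
    (if k = i then spread_skip n (2 * i)
     else if i < k then int n + int k - int i - 2
     else 2 * int n + int k - int i - 2)"
proof -
  have "min i (k + n - 1) = i" "max i (k + n - 1) = k + n - 1" using assms by auto
  moreover have "i \<noteq> k + n - 1" "\<not> k + n - 1 < n" "\<not> n \<le> i" using assms by auto
  moreover have "k + n - 1 + 1 = i + n \<longleftrightarrow> k = i" "i + n \<le> k + n - 1 \<longleftrightarrow> i < k" using assms by auto
  ultimately show ?thesis using assms by (simp add: spread_def Let_def of_nat_diff)
qed

lemma spread_commute: "spread n i j = spread n j i"
  by (simp add: spread_def min.commute max.commute)

lemmas spread_high_low = trans[OF spread_commute spread_low_high]

lemma spread_high_high: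
  assumes "1 \<le> k" "1 \<le> l" "k \<noteq> l"
  shows "spread n (k + n - 1) (l + n - 1) = spread_skip n (k + l)"
proof -
  have "min (k + n - 1) (l + n - 1) \<noteq> max (k + n - 1) (l + n - 1)"
    "\<not> max (k + n - 1) (l + n - 1) < n" "n \<le> min (k + n - 1) (l + n - 1)"
    "min (k + n - 1) (l + n - 1) + max (k + n - 1) (l + n - 1) + 2 - 2 * n = k + l"
    using assms by (auto simp: min_def max_def)
  then show ?thesis by (simp only: spread_def Let_def if_False if_True)
qed

text \<open>Each color is traced back to a partner: in the same half by solving for an index sum or,
  for colors in the gap and for the loop color, in the other half.\<close>

lemma bij_betw_spread:
  assumes n: "n \<ge> 1" and v: "v < 2 * n"
  shows "bij_betw (spread n v) {..<2 * n} {int (spread_start n v)..<int (spread_start n v) + int (2 * n)}"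
proof (rule bij_betw_nat_int_interval)
  fix c' assume c': "int (spread_start n v) \<le> c'" "c' < int (spread_start n v) + int (2 * n)"
  \<comment> \<open>The color counted from 1, to match index sums.\<close>
  define C where "C = nat (c' + 1)"
  have C: "c' = int C - 1" "spread_start n v < C" "C \<le> spread_start n v + 2 * n"
    using c' by (auto simp: C_def)
  show "\<exists>j<2 * n. spread n v j = c'"
  proof (cases "C = spread_start n v + 2 * n")
    case True
    then show ?thesis using v C by (intro exI[of _ v]) (simp add: spread_def)
  next
    case False
    then have Cle: "C < spread_start n v + 2 * n" using C by simp
    show ?thesis
    proof (cases "v < n")
      case True
      then have low: "v \<le> C" "1 \<le> C" "C < 2 * n + v" "v \<ge> 1 \<Longrightarrow> C + 1 < 2 * n + v"
        using C Cle by (auto simp: spread_start_def)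
      \<comment> \<open>In order: below the gap, the loop color there, the gap with
        \<open>k > v\<close> and with \<open>k < v\<close>, past the gap, the loop color there. For
        \<open>v = 0\<close> the color \<open>C = 2 * n - 1\<close> falls under the third case, with
        \<open>k = n\<close>.\<close>
      consider "C < n" "C \<noteq> 2 * v" | "C = 2 * v" "C < n" | "n \<le> C" "C + v < 2 * n"
        | "2 * n \<le> C + v" "C + 1 < 2 * n"
        | "2 * n \<le> C + v" "2 * n \<le> C + 1" "C + 1 \<noteq> n + 2 * v"
        | "C + 1 = n + 2 * v" "2 * n \<le> C + 1" "1 \<le> v"
        using low by linarith
      then show ?thesis
      proof cases
        case 1
        then have "spread n v (C - v) = spread_skip n C"
          using True low by (subst spread_low_low) auto
        with 1 show ?thesis using C(1)
          by (intro exI[of _ "C - v"]) (simp add: spread_skip_def)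
      next
        case 2
        then have "1 \<le> v" using low by simp
        with 2 show ?thesis using True C(1)
          by (intro exI[of _ "v + n - 1"]) (simp add: spread_low_high spread_skip_def del: One_nat_def)
      next
        case 3
        define k where "k = C + v + 1 - n"
        have "1 \<le> k" "v < k" "k \<le> n" "int k = int C + int v + 1 - int n"
          using 3 by (auto simp: k_def)
        then show ?thesis using True C(1) n
          by (intro exI[of _ "k + n - 1"]) (simp add: spread_low_high del: One_nat_def)
      next
        case 4
        define k where "k = C + v + 1 - 2 * n"
        have "1 \<le> k" "k < v" "int k = int C + int v + 1 - 2 * int n"
          using 4 by (auto simp: k_def)
        then show ?thesis using True C(1) n
          by (intro exI[of _ "k + n - 1"]) (simp add: spread_low_high del: One_nat_def)
      next
        case 5
        define j where "j = C + 1 - n - v"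
        have j: "j < n" "v \<noteq> j" "int v + int j = int C + 1 - int n" "n \<le> v + j"
          using 5 True low by (auto simp: j_def)
        then have "spread n v j = c'"
          using True C(1) by (subst spread_low_low) (auto simp: spread_skip_def)
        with j show ?thesis by (intro exI[of _ j]) simp
      next
        case 6
        then have "spread_skip n (2 * v) = c'" using C(1) by (simp add: spread_skip_def)
        with 6 show ?thesis using True
          by (intro exI[of _ "v + n - 1"]) (simp add: spread_low_high del: One_nat_def)
      qed
    next
      case False
      define k where "k = v + 1 - n"
      have k: "v = k + n - 1" "1 \<le> k" "k \<le> n" using False v by (auto simp: k_def)
      \<comment> \<open>At \<open>k = n\<close> all index sums lie past the jump, so the colors
        begin in the gap, at \<open>C = n\<close>; hence the \<open>min\<close> in
        \<open>spread_start\<close>.\<close>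
      have low: "k < n \<Longrightarrow> k < C" "n \<le> k \<Longrightarrow> n \<le> C" "C < 2 * n + k" "k = n \<Longrightarrow> C + 1 < 3 * n"
        using C Cle False k by (auto simp: spread_start_def)
      consider "C < n" "C \<noteq> 2 * k" | "C = 2 * k" "C < n" | "n \<le> C" "C \<le> v"
        | "v < C" "C + 1 < 2 * n"
        | "v < C" "2 * n \<le> C + 1" "C + 1 \<noteq> n + 2 * k" | "C + 1 = n + 2 * k" "2 * n \<le> C + 1" "k < n"
        using low k by linarith
      then show ?thesis
      proof cases
        case 1
        then have "k < n" using low(2) by linarith
        then have "k < C" by (rule low(1))
        define l where "l = C - k"
        have l: "1 \<le> l" "k \<noteq> l" "k + l = C" "l < n" using 1 k \<open>k < C\<close> by (auto simp: l_def)
        then have "spread n v (l + n - 1) = c'"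
          using spread_high_high[OF k(2) l(1,2), of n] 1 k(1) C(1) by (simp add: spread_skip_def)
        with l show ?thesis by (intro exI[of _ "l + n - 1"]) simp
      next
        case 2
        then show ?thesis using k C(1)
          by (intro exI[of _ k]) (simp add: spread_high_low spread_skip_def del: One_nat_def)
      next
        case 3
        define i where "i = v - C"
        have "i < n" "i < k" "int i = int k + int n - 1 - int C"
          using 3 k by (auto simp: i_def)
        then show ?thesis using k C(1)
          by (intro exI[of _ i]) (simp add: spread_high_low del: One_nat_def)
      next
        case 4
        define i where "i = v + n - C"
        have "i < n" "k < i" "int i = int k + 2 * int n - 1 - int C"
          using 4 k by (auto simp: i_def)
        then show ?thesis using k C(1)
          by (intro exI[of _ i]) (simp add: spread_high_low del: One_nat_def)
      next
        case 5
        define l where "l = C + 1 - n - k"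
        have l: "1 \<le> l" "k \<noteq> l" "int k + int l = int C + 1 - int n" "l \<le> n" "n \<le> k + l"
          using 5 k low by (auto simp: l_def)
        then have "spread n v (l + n - 1) = c'"
          using spread_high_high[OF k(2) l(1,2), of n] k(1) C(1) by (simp add: spread_skip_def)
        with l n show ?thesis by (intro exI[of _ "l + n - 1"]) simp
      next
        case 6
        then have "spread_skip n (2 * k) = c'" using C(1) by (simp add: spread_skip_def)
        with 6 show ?thesis using k
          by (intro exI[of _ k]) (simp add: spread_high_low del: One_nat_def)
      qed
    qed
  qed
qed

text \<open>The starts run from 0 at vertex \<open>0\<close> to \<open>n - 1\<close> at vertex
  \<open>2 * n - 1\<close>, and the colors at these two vertices already cover all
  \<open>3 * n - 2\<close> values.\<close>

lemma interval_t_colorable_composition_many: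
  assumes "simple_graph G" "interval_t_colorable G t" "t > 0" and n: "n \<ge> 1"
  shows "interval_t_colorable (composition G (complete_graph (2 * n))) (2 * n * t + (3 * n - 2))"
proof (rule interval_t_colorable_composition[OF assms(1-3),
      where F = "spread n" and s = "\<lambda>i. int (spread_start n i)"])
  have low: "spread_start n i \<le> n - 1" for i
    by (auto simp: spread_start_def)
  show "spread n i j = spread n j i" for i j
    by (rule spread_commute)
  show "bij_betw (spread n i) {..<2 * n} {int (spread_start n i)..<int (spread_start n i) + int (2 * n)}"
    if "i < 2 * n" for i
    using n that by (rule bij_betw_spread)
  show "spread n i i = int (spread_start n i) + int (2 * n) - 1" for i
    by (simp add: spread_def)
  show "int (spread_start n i) + int (2 * n) - 1 \<le> int (3 * n - 2)" if "i < 2 * n" for i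
    using low[of i] n by linarith
  show "\<exists>i<2 * n. int (spread_start n i) = 0"
    using n by (intro exI[of _ 0]) (simp add: spread_start_def)
  show "(\<Union>i<2 * n. {int (spread_start n i)..<int (spread_start n i) + int (2 * n) - 1}) = {0..<int (3 * n - 2)}"
    (is "?L = ?R")
  proof
    have "x < int (3 * n - 2)" if "x < int (spread_start n i) + int (2 * n) - 1" for x i
      using low[of i] n that by linarith
    then show "?L \<subseteq> ?R" by auto
  next
    show "?R \<subseteq> ?L"
    proof
      fix x assume x: "x \<in> ?R"
      show "x \<in> ?L"
      proof (cases "x < 2 * int n - 1")
        case True
        then show ?thesis using x n by (intro UN_I[of 0]) (auto simp: spread_start_def)
      next
        case False
        then show ?thesis using x n
          by (intro UN_I[of "2 * n - 1"]) (auto simp: spread_start_def)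
      qed
    qed
  qed
qed (use n in auto)

section \<open>Bounds on the least and greatest numbers of colors\<close>

theorem theorem7:
  fixes G :: "'a graph" and n :: nat
  assumes "simple_graph G"
    and "interval_colorable G"
    and "n \<ge> 1"
  shows "interval_colorable (composition G (complete_graph (2 * n))) \<and>
    int (min_interval_colors (composition G (complete_graph (2 * n))))
      \<le> (2 * int (min_interval_colors G) + 2) * int n - 1 \<and>
    int (max_interval_colors (composition G (complete_graph (2 * n))))
      \<ge> (2 * int (max_interval_colors G) + 3) * int n - 2"
proof -
  let ?C = "composition G (complete_graph (2 * n))"
  note w = min_interval_colors[OF assms(2)] and W = max_interval_colors[OF assms(1,2)]
  \<comment> \<open>These are \<open>m * t + t'\<close> for \<open>m = 2 * n\<close>, with
    \<open>t' = 2 * n - 1\<close> on a coloring of \<open>G\<close> with fewest colors and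
    \<open>t' = 3 * n - 2\<close> on one with most.\<close>
  let ?few = "2 * n * min_interval_colors G + (2 * n - 1)"
  let ?many = "2 * n * max_interval_colors G + (3 * n - 2)"
  have few: "interval_t_colorable ?C ?few"
    using interval_t_colorable_composition_few[OF assms(1) w(2,1) assms(3)] .
  have many: "interval_t_colorable ?C ?many"
    using interval_t_colorable_composition_many[OF assms(1) W(2,1) assms(3)] .
  have pos: "0 < ?few" "0 < ?many" using assms(3) by auto
  have C: "simple_graph ?C" "interval_colorable ?C"
    using simple_graph_composition[OF assms(1) simple_graph_complete_graph] few pos(1)
    unfolding interval_colorable_def by blast+
  have "int (min_interval_colors ?C) \<le> int ?few"
    using min_interval_colors(3)[OF C(2) pos(1) few] by (rule of_nat_mono)
  moreover have "int ?many \<le> int (max_interval_colors ?C)"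
    using max_interval_colors(3)[OF C pos(2) many] by (rule of_nat_mono)
  ultimately show ?thesis
    using C assms(3) by (simp add: of_nat_diff algebra_simps)
qed

end
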